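(* Let $x$ and $y$ be representations of a countable set $A$. Then $\mathrm{comp}(y)\subseteq\mathrm{comp}(x)$ if and only if, regarding both $r=x\circ y^{-1}:y(A)\to\mathbb{T}$ and the identity $\mathrm{id}_{y(A)}:y(A)\to\mathbb{T}$ as representations of the set $y(A)$, one has $\mathrm{comp}(\mathrm{id}_{y(A)})\subseteq\mathrm{comp}(r)$.
   Context: $\mathbb{T}$ denotes the set of tapes over a fixed finite alphabet with finitely many non-blank symbols. For $Q\subseteq\mathbb{T}$, a function with domain $Q$ and values in $\mathbb{T}$ is computable if some Turing machine, on every input $\tau\in Q$, halts with output equal to the function's value (nothing is required outside $Q$). A representation of a set $S$ is an injective function $s:S\to\mathbb{T}$. For a representation $s$ of $S$, $\mathrm{comp}(s)$ is the set of functions $g$ with domain $S$ and values in $S$ such that $s\circ g\circ s^{-1}$ (defined on $s(S)$) is computable. When $S\subseteq\mathbb{T}$ is itself a set of tapes, an injective map $S\to\mathbb{T}$ (such as $x\circ y^{-1}$ on $S=y(A)$, or the identity of $S$) is called an endorepresentation and $\mathrm{comp}$ is defined for it in the same way. *)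

theory Defs
  imports "HOL-Library.FuncSet" "HOL-Library.Countable_Set"
begin

text \<open>
  The symbols are the elements of \<open>'a option\<close>, where \<open>'a\<close> is finite and \<open>None\<close> is the blank.
  Tapes are infinite in both directions.  Cells are numbered relative to the head: cell 0 is the
  scanned cell, and a move of the head renumbers the cells.  Accordingly a machine reads its input
  from cell 0 on, and its output is the tape as seen from the cell on which it halts; with this
  convention running two machines one after the other composes the functions they compute.
\<close>

typedef ('a::finite) tape = "{t :: int \<Rightarrow> 'a option. finite {i. t i \<noteq> None}}"
  by (rule exI[of _ "\<lambda>_. None"]) simp

setup_lifting type_definition_tape

datatype move = MoveLeft | MoveRight | Stay

fun offset :: "move \<Rightarrow> int" where
  "offset MoveLeft = - 1"
| "offset MoveRight = 1"
| "offset Stay = 0"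

lift_definition scanned :: "'a::finite tape \<Rightarrow> 'a option" is "\<lambda>t. t 0" .

lift_definition write_symbol :: "'a option \<Rightarrow> 'a::finite tape \<Rightarrow> 'a tape" is "\<lambda>b t. t(0 := b)"
proof -
  fix b :: "'a option" and t :: "int \<Rightarrow> 'a option"
  assume "finite {i. t i \<noteq> None}"
  then have "finite (insert 0 {i. t i \<noteq> None})" by simp
  then show "finite {i. (t(0 := b)) i \<noteq> None}" by (rule rev_finite_subset) auto
qed

lift_definition move_head :: "move \<Rightarrow> 'a::finite tape \<Rightarrow> 'a tape" is "\<lambda>m t i. t (i + offset m)"
proof -
  fix m and t :: "int \<Rightarrow> 'a option"
  assume "finite {i. t i \<noteq> None}"
  then have "finite ((\<lambda>i. i - offset m) ` {i. t i \<noteq> None})" by simp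
  then show "finite {i. t (i + offset m) \<noteq> None}"
    by (rule rev_finite_subset) (auto simp: image_iff intro!: exI[of _ "_ + offset m"])
qed

text \<open>
  A machine is a finite table of instructions.  States are natural numbers, only finitely many of
  which occur in the table, the initial state is 0, and the machine halts when no instruction
  applies.
\<close>

type_synonym 'a machine = "nat \<times> 'a option \<rightharpoonup> nat \<times> 'a option \<times> move"

definition turing_machine :: "'a::finite machine \<Rightarrow> bool" where
  "turing_machine M \<longleftrightarrow> finite (dom M)"

definition step :: "'a::finite machine \<Rightarrow> nat \<times> 'a tape \<Rightarrow> (nat \<times> 'a tape) option" where
  "step M = (\<lambda>(q, t). map_option (\<lambda>(q', b, m). (q', move_head m (write_symbol b t))) (M (q, scanned t)))"

definition halts_with_output :: "'a::finite machine \<Rightarrow> 'a tape \<Rightarrow> 'a tape \<Rightarrow> bool" where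
  "halts_with_output M t u \<longleftrightarrow>
     (\<exists>q. (\<lambda>c c'. step M c = Some c')\<^sup>*\<^sup>* (0, t) (q, u) \<and> step M (q, u) = None)"

definition computable_on :: "'a::finite tape set \<Rightarrow> ('a tape \<Rightarrow> 'a tape) \<Rightarrow> bool" where
  "computable_on Q f \<longleftrightarrow> (\<exists>M. turing_machine M \<and> (\<forall>t\<in>Q. halts_with_output M t (f t)))"

definition representation :: "'b set \<Rightarrow> ('b \<Rightarrow> 'a::finite tape) \<Rightarrow> bool" where
  "representation S s \<longleftrightarrow> inj_on s S"

text \<open>
  Functions with domain \<open>S\<close> and values in \<open>S\<close> are rendered as elements of \<open>S \<rightarrow>\<^sub>E S\<close>, which are
  determined by their values on \<open>S\<close>.
\<close>

definition comp_set :: "'b set \<Rightarrow> ('b \<Rightarrow> 'a::finite tape) \<Rightarrow> ('b \<Rightarrow> 'b) set" where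
  "comp_set S s = {g \<in> S \<rightarrow>\<^sub>E S. computable_on (s ` S) (s \<circ> g \<circ> inv_into S s)}"

text \<open>Values of a representation outside its domain are irrelevant.\<close>

lemma comp_set_cong:
  assumes "\<And>a. a \<in> S \<Longrightarrow> s a = s' a"
  shows "comp_set S s = comp_set S s'"
proof -
  have img: "s ` S = s' ` S" using assms by (rule image_cong[OF refl])
  have "inv_into S s t = inv_into S s' t" for t
    unfolding inv_into_def by (rule arg_cong[where f = Eps]) (use assms in auto)
  moreover have "g (inv_into S s' t) \<in> S" if "g \<in> S \<rightarrow>\<^sub>E S" "t \<in> s' ` S" for g t
    using that by (blast intro: PiE_mem inv_into_into)
  ultimately have "(s \<circ> g \<circ> inv_into S s) t = (s' \<circ> g \<circ> inv_into S s') t"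
    if "g \<in> S \<rightarrow>\<^sub>E S" "t \<in> s' ` S" for g t
    using that assms by simp
  then show ?thesis unfolding comp_set_def computable_on_def img by auto
qed

lemma representation_transfer:
  assumes "representation A x" "representation A y"
  shows "representation (y ` A) (x \<circ> inv_into A y)" and "representation (y ` A) id"
  using assms unfolding representation_def by (auto intro!: inj_onI dest: inj_onD)

end

theory Submission
  imports Defs
begin

text \<open>Up to relabelling along the bijection \<open>y\<close> from \<open>A\<close> onto
  \<open>y\<close>
  A\<open>, both inclusions are the same statement. For injective\<close>p\<open>on\<close>A\<open>and\<close>s\<open>on\<close>p
  \<open>A\<close>, the map g \<mapsto> p g p^{-1} is a bijection between the self-maps of
  \<open>A\<close> and those of \<open>p\<close> A\<open>, and it matches\<close>comp_set A (s
  \<circ> p)\<open>with\<close>comp_set (p \<open>A) s\<close>, since both ask for computability of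
  one and the same tape function (\<open>comp_set_comp_iff\<close>). The bijection does not depend
  on \<open>s\<close>, so inclusions transfer (\<open>comp_set_comp_subset_iff\<close>). Take p = y
  and compare s = id with s' = x y^{-1}: composed with \<open>y\<close> these give \<open>y\<close>
  and, on \<open>A\<close>, \<open>x\<close>.\<close>

lemma computable_on_cong:
  assumes "\<And>t. t \<in> Q \<Longrightarrow> f t = f' t"
  shows "computable_on Q f \<longleftrightarrow> computable_on Q f'"
  using assms unfolding computable_on_def by auto

definition conjugate :: "'b set \<Rightarrow> ('b \<Rightarrow> 'c) \<Rightarrow> ('b \<Rightarrow> 'b) \<Rightarrow> 'c \<Rightarrow> 'c" where
  "conjugate A p g = restrict (p \<circ> g \<circ> inv_into A p) (p ` A)"

lemma conjugate_apply:
  assumes "inj_on p A" "a \<in> A"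
  shows "conjugate A p g (p a) = p (g a)"
  using assms by (simp add: conjugate_def)

lemma conjugate_in_PiE:
  assumes "inj_on p A" "g \<in> A \<rightarrow>\<^sub>E A"
  shows "conjugate A p g \<in> p ` A \<rightarrow>\<^sub>E p ` A"
  using assms by (auto simp: conjugate_def intro!: imageI PiE_mem[OF assms(2)])

lemma conjugate_surj:
  assumes inj: "inj_on p A" and h: "h \<in> p ` A \<rightarrow>\<^sub>E p ` A"
  obtains g where "g \<in> A \<rightarrow>\<^sub>E A" "conjugate A p g = h"
proof
  let ?g = "restrict (inv_into A p \<circ> h \<circ> p) A"
  have hp: "h (p a) \<in> p ` A" if "a \<in> A" for a
    using h that by auto
  show g: "?g \<in> A \<rightarrow>\<^sub>E A"
    using hp by (auto intro!: inv_into_into)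
  show "conjugate A p ?g = h"
  proof (rule PiE_ext[OF conjugate_in_PiE[OF inj g] h])
    fix b assume "b \<in> p ` A"
    then obtain a where "a \<in> A" "b = p a" by blast
    then show "conjugate A p ?g b = h b"
      using inj hp[of a] by (simp add: conjugate_apply f_inv_into_f)
  qed
qed

text \<open>The p^{-1} hidden in (s p)^{-1} = p^{-1} s^{-1} can be grouped with \<open>g\<close>: (s
  p) g (s p)^{-1} = s (p g p^{-1}) s^{-1}, on the same set of tapes.\<close>

lemma comp_set_comp_iff:
  assumes p: "inj_on p A" and s: "inj_on s (p ` A)" and g: "g \<in> A \<rightarrow>\<^sub>E A"
  shows "g \<in> comp_set A (s \<circ> p) \<longleftrightarrow> conjugate A p g \<in> comp_set (p ` A) s"
proof -
  have sp: "inj_on (s \<circ> p) A"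
    using p s by (rule comp_inj_on)
  \<comment> \<open>The equality is claimed only on the image, where both \<open>inv_into\<close>
    terms are genuine inverses; computability looks at no other tapes.\<close>
  have "(s \<circ> p \<circ> g \<circ> inv_into A (s \<circ> p)) t = (s \<circ> conjugate A p g \<circ> inv_into (p ` A) s) t"
    if "t \<in> (s \<circ> p) ` A" for t
  proof -
    from that obtain a where a: "a \<in> A" "t = (s \<circ> p) a" by blast
    have "inv_into A (s \<circ> p) t = a"
      unfolding a(2) by (rule inv_into_f_f[OF sp a(1)])
    moreover have "inv_into (p ` A) s t = p a"
      using a s by simp
    ultimately show ?thesis
      using a(1) p by (simp add: conjugate_apply)
  qed
  then have "computable_on ((s \<circ> p) ` A) (s \<circ> p \<circ> g \<circ> inv_into A (s \<circ> p)) \<longleftrightarrow>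
      computable_on ((s \<circ> p) ` A) (s \<circ> conjugate A p g \<circ> inv_into (p ` A) s)"
    by (rule computable_on_cong)
  then show ?thesis
    using g conjugate_in_PiE[OF p g] by (simp add: comp_set_def image_comp)
qed

lemma comp_set_comp_subset_iff:
  assumes p: "inj_on p A" and s: "inj_on s (p ` A)" and s': "inj_on s' (p ` A)"
  shows "comp_set A (s \<circ> p) \<subseteq> comp_set A (s' \<circ> p) \<longleftrightarrow>
    comp_set (p ` A) s \<subseteq> comp_set (p ` A) s'" (is "?L \<longleftrightarrow> ?R")
proof
  assume L: ?L
  show ?R
  proof
    fix h assume h: "h \<in> comp_set (p ` A) s"
    then have "h \<in> p ` A \<rightarrow>\<^sub>E p ` A" by (simp add: comp_set_def)
    with p obtain g where "g \<in> A \<rightarrow>\<^sub>E A" "conjugate A p g = h" by (rule conjugate_surj)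
    then show "h \<in> comp_set (p ` A) s'"
      using L h comp_set_comp_iff[OF p s] comp_set_comp_iff[OF p s'] by blast
  qed
next
  assume R: ?R
  show ?L
  proof
    fix g assume g: "g \<in> comp_set A (s \<circ> p)"
    then have "g \<in> A \<rightarrow>\<^sub>E A" by (simp add: comp_set_def)
    then show "g \<in> comp_set A (s' \<circ> p)"
      using R g comp_set_comp_iff[OF p s] comp_set_comp_iff[OF p s'] by blast
  qed
qed

theorem theorem7:
  fixes A :: "'b set" and x y :: "'b \<Rightarrow> 'a::finite tape"
  assumes "countable A"
    and "representation A x"
    and "representation A y"
  shows "comp_set A y \<subseteq> comp_set A x \<longleftrightarrow>
    comp_set (y ` A) id \<subseteq> comp_set (y ` A) (x \<circ> inv_into A y)"
proof -
  have y: "inj_on y A"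
    using assms(3) by (simp add: representation_def)
  have r: "inj_on (x \<circ> inv_into A y) (y ` A)"
    using representation_transfer(1)[OF assms(2,3)] by (simp add: representation_def)
  \<comment> \<open>The two representations agree on \<open>A\<close> but may differ off it, hence
    the congruence rule instead of rewriting.\<close>
  have "comp_set A x = comp_set A (x \<circ> inv_into A y \<circ> y)"
    using y by (intro comp_set_cong) simp
  then show ?thesis
    using comp_set_comp_subset_iff[OF y inj_on_id r] by simp
qed

end
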